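(* Let $k \geq 1$ be an integer and let $G$ be a connected $n$-vertex graph such that $(G,k)$ is not special. Let $\mathcal{F} = \mathcal{F}_{0,k} \cup \mathcal{F}_{1,k}$. Then \[\iota(G,\mathcal{F}) \leq \left\lfloor \frac{n}{k+1} \right\rfloor.\] Moreover, equality holds if $G = B_{n,k}$.
   Context: All graphs are finite and simple. For a vertex $v$, $N[v]$ is its closed neighbourhood, and for $D \subseteq V(G)$, $N[D] = \bigcup_{v \in D} N[v]$. Given a set $\mathcal{F}$ of graphs, an $\mathcal{F}$-graph is a graph isomorphic to a member of $\mathcal{F}$. A set $D \subseteq V(G)$ is $\mathcal{F}$-isolating if $G - N[D]$ contains no $\mathcal{F}$-graph as a subgraph, and $\iota(G,\mathcal{F})$ is the minimum size of an $\mathcal{F}$-isolating set of $G$. $K_{1,k}$ denotes the star with $k$ leaves. $\mathcal{F}_{0,k} = \{K_{1,k}\}$, and $\mathcal{F}_{1,k}$ is the set of all regular graphs whose degree is at least $k-1$. The pair $(G,k)$ is called special if either $G$ is a $k$-clique (a copy of $K_k$), or $k = 2$ and $G$ is a $5$-cycle. The graph $B_{n,k}$ ($n,k \geq 1$) is defined as follows: let $q = \lfloor n/(k+1) \rfloor$ and $n = q(k+1) + r$ with $0 \leq r \leq k$. If $q = 0$, $B_{n,k} = K_r$. If $q \geq 1$, take pairwise vertex-disjoint cliques $B_1, \dots, B_q$ on $k+1$ vertices each and $B_{q+1}$ on $r$ vertices; let $q' = q$ if $r = 0$ and $q' = q+1$ if $r \geq 1$; choose $b_i \in V(B_i)$ for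 $i \in [q']$; then $B_{n,k}$ has vertex set $\bigcup_{i=1}^{q'} V(B_i)$ and edge set $\{b_ib_{i+1} : i \in [q'-1]\} \cup \bigcup_{i=1}^{q'} E(B_i)$. *)

theory Defs
  imports Main
begin

text \<open>Finite simple graphs: a finite vertex set V and a set E of 2-element subsets of V.\<close>

definition graph :: "'a set \<Rightarrow> 'a set set \<Rightarrow> bool" where
  "graph V E \<longleftrightarrow> finite V \<and> (\<forall>e\<in>E. e \<subseteq> V \<and> card e = 2)"

text \<open>Closed neighbourhood N[v] and N[D].\<close>
definition closed_nbhd :: "'a set \<Rightarrow> 'a set set \<Rightarrow> 'a \<Rightarrow> 'a set" where
  "closed_nbhd V E v = {v} \<union> {u\<in>V. {u, v} \<in> E}"

definition closed_nbhd_set :: "'a set \<Rightarrow> 'a set set \<Rightarrow> 'a set \<Rightarrow> 'a set" where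
  "closed_nbhd_set V E D = (\<Union>v\<in>D. closed_nbhd V E v)"

text \<open>Edges of the subgraph induced by S.\<close>
definition induced_edges :: "'a set set \<Rightarrow> 'a set \<Rightarrow> 'a set set" where
  "induced_edges E S = {e\<in>E. e \<subseteq> S}"

definition subgraph :: "'a set \<Rightarrow> 'a set set \<Rightarrow> 'a set \<Rightarrow> 'a set set \<Rightarrow> bool" where
  "subgraph V' E' V E \<longleftrightarrow> V' \<subseteq> V \<and> E' \<subseteq> E \<and> (\<forall>e\<in>E'. e \<subseteq> V')"

definition degree :: "'a set set \<Rightarrow> 'a \<Rightarrow> nat" where
  "degree E v = card {e\<in>E. v \<in> e}"

definition regular_of :: "'a set \<Rightarrow> 'a set set \<Rightarrow> nat \<Rightarrow> bool" where
  "regular_of V E r \<longleftrightarrow> (\<forall>v\<in>V. degree E v = r)"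

text \<open>(V,E) is isomorphic to the star K_{1,k}.\<close>
definition is_star :: "nat \<Rightarrow> 'a set \<Rightarrow> 'a set set \<Rightarrow> bool" where
  "is_star k V E \<longleftrightarrow> (\<exists>c L. finite L \<and> c \<notin> L \<and> card L = k \<and> V = insert c L \<and>
                          E = (\<lambda>l. {c, l}) ` L)"

text \<open>(V,E) is an F-graph for F = F_{0,k} \<union> F_{1,k}: isomorphic to K_{1,k}, or a (nonempty)
  regular graph of degree at least k-1 (regularity is invariant under isomorphism).\<close>
definition F_graph :: "nat \<Rightarrow> 'a set \<Rightarrow> 'a set set \<Rightarrow> bool" where
  "F_graph k V E \<longleftrightarrow> is_star k V E \<or> (V \<noteq> {} \<and> (\<exists>r. r \<ge> k - 1 \<and> regular_of V E r))"

definition contains_F :: "nat \<Rightarrow> 'a set \<Rightarrow> 'a set set \<Rightarrow> bool" where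
  "contains_F k V E \<longleftrightarrow> (\<exists>V' E'. subgraph V' E' V E \<and> F_graph k V' E')"

definition isolating :: "nat \<Rightarrow> 'a set \<Rightarrow> 'a set set \<Rightarrow> 'a set \<Rightarrow> bool" where
  "isolating k V E D \<longleftrightarrow> D \<subseteq> V \<and>
     \<not> contains_F k (V - closed_nbhd_set V E D) (induced_edges E (V - closed_nbhd_set V E D))"

text \<open>iota(G, F_{0,k} \<union> F_{1,k}).\<close>
definition iota :: "nat \<Rightarrow> 'a set \<Rightarrow> 'a set set \<Rightarrow> nat" where
  "iota k V E = (LEAST m. \<exists>D. isolating k V E D \<and> card D = m)"

definition connected_graph :: "'a set \<Rightarrow> 'a set set \<Rightarrow> bool" where
  "connected_graph V E \<longleftrightarrow> V \<noteq> {} \<and>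
     (\<forall>u\<in>V. \<forall>v\<in>V. (u, v) \<in> {(x, y). {x, y} \<in> E}\<^sup>*)"

definition complete_graph :: "'a set \<Rightarrow> 'a set set \<Rightarrow> bool" where
  "complete_graph V E \<longleftrightarrow> E = {{u, v} | u v. u \<in> V \<and> v \<in> V \<and> u \<noteq> v}"

definition is_C5 :: "'a set \<Rightarrow> 'a set set \<Rightarrow> bool" where
  "is_C5 V E \<longleftrightarrow> (\<exists>f. bij_betw f {0..<(5::nat)} V \<and>
                        E = {{f i, f ((i + 1) mod 5)} | i. i < 5})"

definition special :: "nat \<Rightarrow> 'a set \<Rightarrow> 'a set set \<Rightarrow> bool" where
  "special k V E \<longleftrightarrow> (card V = k \<and> complete_graph V E) \<or> (k = 2 \<and> is_C5 V E)"

definition graph_iso :: "'a set \<Rightarrow> 'a set set \<Rightarrow> 'b set \<Rightarrow> 'b set set \<Rightarrow> bool" where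
  "graph_iso V E V' E' \<longleftrightarrow> (\<exists>f. bij_betw f V V' \<and>
      (\<forall>u\<in>V. \<forall>v\<in>V. {u, v} \<in> E \<longleftrightarrow> {f u, f v} \<in> E'))"

text \<open>B_{n,k} on vertex set {0..<n}: block i is {i(k+1) ..< min n ((i+1)(k+1))}, a clique;
  b_i = i(k+1) is the first vertex of block i, and b_i b_{i+1} is an edge.\<close>
definition B_vert :: "nat \<Rightarrow> nat set" where
  "B_vert n = {0..<n}"

definition B_edges :: "nat \<Rightarrow> nat \<Rightarrow> nat set set" where
  "B_edges n k = {{u, v} | u v. u < n \<and> v < n \<and> u \<noteq> v \<and>
      (u div (k + 1) = v div (k + 1) \<or> (u mod (k + 1) = 0 \<and> v = u + (k + 1)))}"

end

theory Submission
  imports Defs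
begin

text \<open>Upper bound, by induction on the number of vertices. If the maximum degree is less than \<open>k\<close>, a
  connected graph that contains a member of the family is \<open>(k - 1)\<close>-regular, and removing the closed
  neighbourhood of any vertex leaves no regular part. If \<open>G - x\<close> has a special component for some
  vertex \<open>x\<close>, take \<open>x\<close>: each special component loses a vertex, which saves enough. Otherwise let \<open>v\<close>
  have maximum degree. If \<open>G - N[v]\<close> has a special component \<open>H\<close>, with a vertex \<open>y\<close> adjacent to
  some \<open>x \<in> N(v)\<close>, then \<open>H\<close> and \<open>x\<close> are dominated cheaply by a set containing \<open>y\<close>, and among the
  components of the rest only that of \<open>v\<close> can be special; in that case the maximality of the degree
  of \<open>v\<close> leaves only a few small configurations.

  Lower bound for \<open>B\<^bsub>n,k\<^esub>\<close>: an isolating set meets each of the \<open>(k + 1)\<close>-cliques, since otherwise its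
  closed neighbourhood meets that clique in at most the connecting vertex and misses a \<open>k\<close>-clique.\<close>

section \<open>Isolation in terms of an adjacency relation\<close>

locale sgraph =
  fixes adj :: "'a \<Rightarrow> 'a \<Rightarrow> bool" and k :: nat
  assumes adj_sym: "adj u w \<Longrightarrow> adj w u"
    and adj_irrefl: "\<not> adj u u"
    and k_pos: "1 \<le> k"
begin

definition nb :: "'a set \<Rightarrow> 'a \<Rightarrow> 'a set" where
  "nb S u = {w \<in> S. adj u w}"

text \<open>There is no host vertex set here, so that one and the same \<open>cn D\<close> can be
  subtracted from \<open>S\<close>, from a component and from the rest.\<close>

definition cn :: "'a set \<Rightarrow> 'a set" where
  "cn D = D \<union> {u. \<exists>d\<in>D. adj d u}"

text \<open>A subgraph of minimum degree at least \<open>k - 1\<close> in a graph of maximum degree less than \<open>k\<close> is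
  \<open>(k - 1)\<close>-regular, so \<open>ffree S\<close> says that the graph induced by \<open>S\<close> contains no member of the family.\<close>
definition ffree :: "'a set \<Rightarrow> bool" where
  "ffree S \<longleftrightarrow> (\<forall>u\<in>S. card (nb S u) < k) \<and>
     (\<forall>W. W \<subseteq> S \<and> W \<noteq> {} \<longrightarrow> (\<exists>u\<in>W. card (nb W u) < k - 1))"

text \<open>In \<open>good_rel X S\<close> the closed neighbourhood of the set \<open>X\<close>, usually outside \<open>S\<close>, is removed for free.\<close>
definition good_rel :: "'a set \<Rightarrow> 'a set \<Rightarrow> bool" where
  "good_rel X S \<longleftrightarrow> (\<exists>D\<subseteq>S. ffree (S - cn (X \<union> D)) \<and> (k + 1) * card D \<le> card S)"

abbreviation "good \<equiv> good_rel {}"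

definition no_edges :: "'a set \<Rightarrow> 'a set \<Rightarrow> bool" where
  "no_edges A B \<longleftrightarrow> (\<forall>a\<in>A. \<forall>b\<in>B. \<not> adj a b)"

text \<open>Connectedness by cuts instead of paths: it is applied by exhibiting a part without
  outgoing edges, and no path ever has to be handled.\<close>

definition conn :: "'a set \<Rightarrow> bool" where
  "conn S \<longleftrightarrow> S \<noteq> {} \<and> (\<forall>W. W \<subseteq> S \<and> W \<noteq> {} \<and> no_edges W (S - W) \<longrightarrow> W = S)"

definition comp :: "'a set \<Rightarrow> 'a set \<Rightarrow> bool" where
  "comp T C \<longleftrightarrow> C \<subseteq> T \<and> conn C \<and> no_edges C (T - C)"

definition clique :: "'a set \<Rightarrow> bool" where
  "clique S \<longleftrightarrow> (\<forall>u\<in>S. \<forall>w\<in>S. u \<noteq> w \<longrightarrow> adj u w)"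

definition cyc5 :: "'a \<Rightarrow> 'a \<Rightarrow> 'a \<Rightarrow> 'a \<Rightarrow> 'a \<Rightarrow> bool" where
  "cyc5 a b c d e \<longleftrightarrow> distinct [a, b, c, d, e] \<and>
     adj a b \<and> adj b c \<and> adj c d \<and> adj d e \<and> adj e a \<and>
     \<not> adj a c \<and> \<not> adj b d \<and> \<not> adj c e \<and> \<not> adj d a \<and> \<not> adj e b"

definition spec :: "'a set \<Rightarrow> bool" where
  "spec S \<longleftrightarrow> (card S = k \<and> clique S) \<or>
     (k = 2 \<and> (\<exists>a b c d e. S = {a, b, c, d, e} \<and> cyc5 a b c d e))"

section \<open>Neighbourhoods and closure properties of \<open>ffree\<close>\<close>

lemma adj_commute: "adj u w \<longleftrightarrow> adj w u"
  using adj_sym by blast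

lemma no_edgesD: "no_edges A B \<Longrightarrow> a \<in> A \<Longrightarrow> b \<in> B \<Longrightarrow> \<not> adj a b"
  by (auto simp: no_edges_def)

lemma finite_nb: "finite S \<Longrightarrow> finite (nb S u)"
  by (simp add: nb_def)

lemma nb_mono: "A \<subseteq> B \<Longrightarrow> nb A u \<subseteq> nb B u"
  by (auto simp: nb_def)

lemma card_nb_mono: "finite B \<Longrightarrow> A \<subseteq> B \<Longrightarrow> card (nb A u) \<le> card (nb B u)"
  by (intro card_mono finite_nb nb_mono)

lemma card_nb_less: "finite S \<Longrightarrow> u \<in> S \<Longrightarrow> card (nb S u) < card S"
  using adj_irrefl by (intro psubset_card_mono) (auto simp: nb_def)

lemma spec_finite: "spec S \<Longrightarrow> finite S"
  using k_pos by (auto simp: spec_def intro: card_ge_0_finite)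

lemma ffree_mono:
  assumes "ffree S" "S' \<subseteq> S" "finite S"
  shows "ffree S'"
  unfolding ffree_def
proof (intro conjI ballI allI impI)
  fix u assume "u \<in> S'"
  then show "card (nb S' u) < k"
    using assms card_nb_mono[OF assms(3,2), of u] unfolding ffree_def by fastforce
next
  fix W assume "W \<subseteq> S' \<and> W \<noteq> {}"
  then show "\<exists>u\<in>W. card (nb W u) < k - 1"
    using assms unfolding ffree_def by blast
qed

lemma ffree_empty: "ffree {}"
  by (auto simp: ffree_def)

text \<open>On fewer than \<open>k\<close> vertices every degree is at most \<open>k - 2\<close>, in
  every induced part as well.\<close>

lemma ffree_small:
  assumes "finite S" "card S < k"
  shows "ffree S"
  unfolding ffree_def
proof (intro conjI ballI allI impI)
  fix u assume "u \<in> S"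
  then show "card (nb S u) < k"
    using card_nb_less[OF assms(1)] assms(2) by fastforce
next
  fix W assume W: "W \<subseteq> S \<and> W \<noteq> {}"
  then obtain u where u: "u \<in> W" by blast
  have "finite W" "card W \<le> card S"
    using W assms(1) by (auto intro: finite_subset card_mono)
  then show "\<exists>u\<in>W. card (nb W u) < k - 1"
    using card_nb_less[of W u] u assms(2) by (intro bexI[of _ u]) auto
qed

lemma ffree_indep:
  assumes "no_edges S S" "2 \<le> k"
  shows "ffree S"
proof -
  have "nb W u = {}" if "W \<subseteq> S" "u \<in> W" for W u
    using that assms(1) by (auto simp: nb_def no_edges_def)
  then show ?thesis
    unfolding ffree_def using assms(2) by fastforce
qed

text \<open>All neighbours of a vertex lie on its own side, so a vertex of low degree in
  \<open>W \<inter> A\<close> or \<open>W \<inter> B\<close> has the same low degree in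
  \<open>W\<close>.\<close>

lemma ffree_Un:
  assumes "ffree A" "ffree B" "no_edges A B"
  shows "ffree (A \<union> B)"
proof -
  have nbA: "nb W u = nb (W \<inter> A) u" if "u \<in> A" "W \<subseteq> A \<union> B" for u W
    using that assms(3) by (auto simp: nb_def no_edges_def)
  have nbB: "nb W u = nb (W \<inter> B) u" if "u \<in> B" "W \<subseteq> A \<union> B" for u W
    using that assms(3) adj_sym by (fastforce simp: nb_def no_edges_def)
  show ?thesis
    unfolding ffree_def
  proof (intro conjI ballI allI impI)
    fix u assume "u \<in> A \<union> B"
    moreover have "(A \<union> B) \<inter> A = A" "(A \<union> B) \<inter> B = B" by auto
    ultimately show "card (nb (A \<union> B) u) < k"
      using nbA[of u "A \<union> B"] nbB[of u "A \<union> B"] assms(1,2) by (auto simp: ffree_def)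
  next
    fix W assume W: "W \<subseteq> A \<union> B \<and> W \<noteq> {}"
    show "\<exists>u\<in>W. card (nb W u) < k - 1"
    proof (cases "W \<inter> A = {}")
      case True
      then have "W \<subseteq> B" using W by blast
      then show ?thesis using W assms(2) by (auto simp: ffree_def)
    next
      case False
      then obtain u where "u \<in> W \<inter> A" "card (nb (W \<inter> A) u) < k - 1"
        using assms(1) unfolding ffree_def by (meson inf_le2)
      then show ?thesis using nbA[of u W] W by (intro bexI[of _ u]) auto
    qed
  qed
qed

section \<open>Relative isolation and gluing\<close>

lemma cn_Un: "cn (A \<union> B) = cn A \<union> cn B"
  by (auto simp: cn_def)

lemma good_rel_mono:
  assumes "good S" "finite S"
  shows "good_rel X S"
proof -
  obtain D where D: "D \<subseteq> S" "ffree (S - cn ({} \<union> D))" "(k + 1) * card D \<le> card S"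
    using assms(1) unfolding good_rel_def by blast
  have "ffree (S - cn (X \<union> D))"
    by (rule ffree_mono[OF D(2)]) (use assms(2) in \<open>auto simp: cn_def\<close>)
  then show ?thesis using D unfolding good_rel_def by blast
qed

text \<open>The counting scheme of the induction: the removed part \<open>S - T\<close> pays
  \<open>k + 1\<close> vertices for each member of \<open>D0\<close>, and \<open>T\<close> is solved
  within its own budget, with \<open>cn D0\<close> already gone.\<close>

lemma good_extend:
  assumes "finite S" "D0 \<subseteq> S" "T \<subseteq> S" "good_rel D0 T"
    and "no_edges T (S - T - cn D0)" "ffree (S - T - cn D0)"
    and "(k + 1) * card D0 \<le> card (S - T)"
  shows "good S"
proof -
  obtain D where D: "D \<subseteq> T" "ffree (T - cn (D0 \<union> D))" "(k + 1) * card D \<le> card T"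
    using assms(4) unfolding good_rel_def by blast
  have "ffree ((T - cn (D0 \<union> D)) \<union> (S - T - cn D0))"
    by (rule ffree_Un) (use D assms in \<open>auto simp: no_edges_def\<close>)
  then have "ffree (S - cn (D0 \<union> D))"
    by (rule ffree_mono) (use assms in \<open>auto simp: cn_Un intro: finite_subset\<close>)
  moreover have "card S = card T + card (S - T)"
    using assms by (metis card_Diff_subset card_mono finite_subset le_add_diff_inverse)
  moreover have "(k + 1) * card (D0 \<union> D) \<le> (k + 1) * (card D0 + card D)"
    by (intro mult_le_mono2 card_Un_le)
  ultimately show ?thesis
    unfolding good_rel_def using D assms
    by (intro exI[of _ "D0 \<union> D"]) (auto simp: algebra_simps)
qed

section \<open>Connected components\<close>

lemma comp_exists:
  assumes "finite T" "u \<in> T"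
  obtains C where "comp T C" "u \<in> C"
proof -
  let ?P = "\<lambda>C. C \<subseteq> T \<and> u \<in> C \<and> no_edges C (T - C)"
  have "?P T" using assms by (auto simp: no_edges_def)
  \<comment> \<open>A smallest closed set around \<open>u\<close>: a proper closed part
    \<open>W\<close> contradicts minimality, either by itself or through its complement
    \<open>C - W\<close>, whichever contains \<open>u\<close>.\<close>
  then obtain C where C: "?P C" and min: "\<And>C'. ?P C' \<Longrightarrow> card C \<le> card C'"
    using ex_has_least_nat[of ?P T card] by blast
  have fin: "finite C" using C assms finite_subset by blast
  have "W = C" if W: "W \<subseteq> C" "W \<noteq> {}" "no_edges W (C - W)" for W
  proof (cases "u \<in> W")
    case True
    have "?P W" using W C True unfolding no_edges_def by blast
    then show ?thesis using min[of W] W fin by (simp add: card_seteq)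
  next
    case False
    have "no_edges (C - W) (T - (C - W))"
      using W C adj_sym unfolding no_edges_def by blast
    then have "?P (C - W)" using C False by auto
    then have "C - W = C" using min[of "C - W"] fin by (intro card_seteq) auto
    then show ?thesis using W by blast
  qed
  then have "conn C" using C by (auto simp: conn_def)
  then show ?thesis using that C by (auto simp: comp_def)
qed

lemma connD: "conn S \<Longrightarrow> W \<subseteq> S \<Longrightarrow> W \<noteq> {} \<Longrightarrow> no_edges W (S - W) \<Longrightarrow> W = S"
  by (auto simp: conn_def)

lemma comp_disjoint_or_eq:
  assumes "comp T C" "comp T C'" "u \<in> C" "u \<in> C'"
  shows "C = C'"
proof -
  have "C \<inter> C' = C"
    by (rule connD) (use assms in \<open>unfold comp_def no_edges_def, blast+\<close>)
  moreover have "C \<inter> C' = C'"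
    by (rule connD) (use assms in \<open>unfold comp_def no_edges_def, blast+\<close>)
  ultimately show ?thesis by simp
qed

lemma comp_superset:
  "comp T C \<Longrightarrow> T \<subseteq> T' \<Longrightarrow> no_edges C (T' - T) \<Longrightarrow> comp T' C"
  unfolding comp_def no_edges_def by blast

text \<open>The bound is linear in the number of vertices, so the budgets of the components add up.
  One component is split off, and those of the remainder are still components of
  \<open>T\<close>.\<close>

lemma good_rel_components:
  assumes "finite T" "\<And>C. comp T C \<Longrightarrow> good_rel X C"
  shows "good_rel X T"
  using assms
proof (induction "card T" arbitrary: T rule: less_induct)
  case less
  show ?case
  proof (cases "T = {}")
    case True
    then show ?thesis by (auto simp: good_rel_def ffree_empty)
  next
    case False
    then obtain u C where C: "comp T C" "u \<in> C"
      using comp_exists less.prems(1) by blast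
    have sub: "C \<subseteq> T" and ne: "no_edges C (T - C)" using C by (auto simp: comp_def)
    have "card (T - C) < card T"
      using C(2) sub less.prems(1) by (intro psubset_card_mono) auto
    moreover have "good_rel X C'" if "comp (T - C) C'" for C'
    proof (rule less.prems(2), rule comp_superset[OF that])
      show "no_edges C' (T - (T - C))"
        using that ne adj_sym unfolding comp_def no_edges_def by blast
    qed auto
    ultimately have "good_rel X (T - C)"
      using less.hyps[of "T - C"] less.prems(1) by blast
    then obtain D where D: "D \<subseteq> T - C" "ffree (T - C - cn (X \<union> D))"
        "(k + 1) * card D \<le> card (T - C)"
      unfolding good_rel_def by blast
    obtain D' where D': "D' \<subseteq> C" "ffree (C - cn (X \<union> D'))" "(k + 1) * card D' \<le> card C"
      using less.prems(2)[OF C(1)] unfolding good_rel_def by blast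
    have "ffree ((C - cn (X \<union> D')) \<union> (T - C - cn (X \<union> D)))"
      by (rule ffree_Un) (use D D' ne in \<open>auto simp: no_edges_def\<close>)
    then have "ffree (T - cn (X \<union> (D \<union> D')))"
      by (rule ffree_mono) (use less.prems(1) sub in \<open>auto simp: cn_Un intro: finite_subset\<close>)
    moreover have "card T = card C + card (T - C)"
      using sub less.prems(1) by (metis card_Diff_subset card_mono finite_subset le_add_diff_inverse)
    moreover have "(k + 1) * card (D \<union> D') \<le> (k + 1) * (card D + card D')"
      by (intro mult_le_mono2 card_Un_le)
    ultimately show ?thesis
      unfolding good_rel_def using D D' sub
      by (intro exI[of _ "D \<union> D'"]) (auto simp: algebra_simps)
  qed
qed

section \<open>Special graphs\<close>

lemma cyc5_rotate: "cyc5 a b c d e \<Longrightarrow> cyc5 b c d e a"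
  by (auto simp: cyc5_def)

text \<open>The cycle is rotated to begin at \<open>z\<close>, so that later arguments need only one
  labelling.\<close>

lemma spec_cases:
  assumes "spec S" "z \<in> S"
  obtains (clique) "card S = k" "clique S"
  | (cycle) b c d e where "k = 2" "S = {z, b, c, d, e}" "cyc5 z b c d e"
proof (cases "card S = k \<and> clique S")
  case True
  then show ?thesis using clique by blast
next
  case False
  then obtain p q r s t where k2: "k = 2" and S: "S = {p, q, r, s, t}" and c: "cyc5 p q r s t"
    using assms by (auto simp: spec_def)
  note c2 = cyc5_rotate[OF c]
  note c3 = cyc5_rotate[OF c2]
  note c4 = cyc5_rotate[OF c3]
  note c5 = cyc5_rotate[OF c4]
  have "z = p \<or> z = q \<or> z = r \<or> z = s \<or> z = t" using assms(2) S by simp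
  then show ?thesis
  proof (elim disjE)
    assume "z = p" then show ?thesis using cycle[OF k2, of q r s t] S c by auto
  next
    assume "z = q" then show ?thesis using cycle[OF k2, of r s t p] S c2 by auto
  next
    assume "z = r" then show ?thesis using cycle[OF k2, of s t p q] S c3 by auto
  next
    assume "z = s" then show ?thesis using cycle[OF k2, of t p q r] S c4 by auto
  next
    assume "z = t" then show ?thesis using cycle[OF k2, of p q r s] S c5 by auto
  qed
qed

lemma cyc5_card: "cyc5 a b c d e \<Longrightarrow> card {a, b, c, d, e} = 5"
  by (auto simp: cyc5_def)

text \<open>Losing \<open>z\<close> leaves a clique with fewer than \<open>k\<close> vertices, and a
  5-cycle as a path on four vertices, of which \<open>c\<close> dominates all but one. The surplus
  of \<open>k\<close> vertices will pay, together with one further vertex, for putting a neighbour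
  of \<open>z\<close> into the isolating set.\<close>

lemma spec_isolate_remove:
  assumes "spec H" "z \<in> H"
  obtains D where "D \<subseteq> H" "card (H - {z} - cn D) < k" "(k + 1) * card D + k \<le> card H"
  using assms
proof (cases rule: spec_cases)
  case clique
  have "card (H - {z} - cn {}) < k"
    using clique(1) assms(2) spec_finite[OF assms(1)] k_pos by (simp add: cn_def)
  then show ?thesis using that[of "{}"] clique by auto
next
  case (cycle b c d e)
  have "H - {z} - cn {c} \<subseteq> {e}"
    using cycle by (auto simp: cn_def cyc5_def adj_commute)
  then have "card (H - {z} - cn {c}) \<le> 1"
    using card_mono[of "{e}"] by fastforce
  then show ?thesis using that[of "{c}"] cycle cyc5_card[OF cycle(3)] by auto
qed

text \<open>One vertex dominates a clique and two dominate a 5-cycle, which exceeds the budget of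
  \<open>H\<close> by one vertex. A neighbour of \<open>z\<close> outside \<open>H\<close> can pay
  for it, as \<open>z \<in> D\<close> dominates that neighbour too.\<close>

lemma spec_dominate:
  assumes "spec H" "z \<in> H"
  obtains D where "D \<subseteq> H" "H \<subseteq> cn D" "z \<in> D" "(k + 1) * card D \<le> card H + 1"
  using assms
proof (cases rule: spec_cases)
  case clique
  have "H \<subseteq> cn {z}"
    using clique(2) assms(2) by (auto simp: cn_def clique_def)
  then show ?thesis using that[of "{z}"] clique assms by auto
next
  case (cycle b c d e)
  have "H \<subseteq> cn {z, c}"
    using cycle by (auto simp: cn_def cyc5_def adj_commute)
  moreover have "card {z, c} = 2" using cycle(3) by (auto simp: cyc5_def)
  ultimately show ?thesis using that[of "{z, c}"] cycle cyc5_card[OF cycle(3)] by auto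
qed

lemma card_nb_clique:
  assumes "clique H" "finite H" "z \<in> H"
  shows "card (nb H z) = card H - 1"
proof -
  have "nb H z = H - {z}"
    using assms by (auto simp: nb_def clique_def adj_irrefl)
  then show ?thesis using assms by simp
qed

lemma card_nb_spec:
  assumes "spec H" "z \<in> H"
  shows "k - 1 \<le> card (nb H z)"
  using assms
proof (cases rule: spec_cases)
  case clique
  then show ?thesis using card_nb_clique assms spec_finite by auto
next
  case (cycle b c d e)
  have "{b} \<subseteq> nb H z" using cycle by (auto simp: nb_def cyc5_def)
  then have "card {b} \<le> card (nb H z)"
    by (intro card_mono finite_nb spec_finite assms(1))
  then show ?thesis using cycle(1) by simp
qed

lemma spec_good_rel:
  assumes "spec C" "z \<in> C" "adj x z"
  obtains D where "D \<subseteq> C" "ffree (C - cn (insert x D))" "(k + 1) * card D + k \<le> card C"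
proof -
  obtain D where D: "D \<subseteq> C" "card (C - {z} - cn D) < k" "(k + 1) * card D + k \<le> card C"
    using spec_isolate_remove assms by metis
  have fin: "finite C" using assms spec_finite by blast
  have "ffree (C - {z} - cn D)" using D fin ffree_small by blast
  then have "ffree (C - cn (insert x D))"
    by (rule ffree_mono) (use assms fin in \<open>auto simp: cn_def\<close>)
  then show ?thesis using that D by blast
qed

lemma comp_adjacent_cut:
  assumes "conn S" "x \<in> S" "comp (S - {x}) C"
  obtains z where "z \<in> C" "adj x z"
proof -
  have "\<not> no_edges C (S - C)"
    using connD[OF assms(1), of C] assms by (auto simp: comp_def conn_def)
  then show ?thesis using that assms adj_sym by (fastforce simp: comp_def no_edges_def)
qed

text \<open>By connectedness every component of \<open>S - {x}\<close> contains a neighbour of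
  \<open>x\<close>, so all special ones become affordable once \<open>x\<close> is chosen. The cost
  of \<open>x\<close> is paid by \<open>x\<close> itself and the surplus \<open>k\<close> of
  \<open>C0\<close>.\<close>

lemma good_if_cut_special:
  assumes "finite S" "conn S" "x \<in> S" "comp (S - {x}) C0" "spec C0"
    and IH: "\<And>C. card C < card S \<Longrightarrow> finite C \<Longrightarrow> conn C \<Longrightarrow> \<not> spec C \<Longrightarrow> good C"
  shows "good S"
proof -
  let ?T = "S - {x} - C0"
  have C0: "C0 \<subseteq> S - {x}" "no_edges C0 ?T" using assms(4) by (auto simp: comp_def)
  obtain z where "z \<in> C0" "adj x z" using comp_adjacent_cut assms by blast
  then obtain D where D: "D \<subseteq> C0" "ffree (C0 - cn (insert x D))" "(k + 1) * card D + k \<le> card C0"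
    using spec_good_rel assms(5) by metis
  have "good_rel (insert x D) ?T"
  proof (rule good_rel_components)
    fix C assume C: "comp ?T C"
    have Cx: "comp (S - {x}) C"
      by (rule comp_superset[OF C])
        (use C C0 adj_sym in \<open>unfold comp_def no_edges_def, blast+\<close>)
    have Csub: "C \<subseteq> S - {x}" using Cx by (simp add: comp_def)
    have fin: "finite C" using Csub assms(1) finite_subset by blast
    show "good_rel (insert x D) C"
    proof (cases "spec C")
      case False
      have "card C < card S" using Csub assms(1,3) by (intro psubset_card_mono) auto
      then have "good C" using IH False Cx fin by (auto simp: comp_def)
      then show ?thesis using good_rel_mono fin by blast
    next
      case True
      obtain z where "z \<in> C" "adj x z" using comp_adjacent_cut assms Cx by blast
      then obtain D' where D': "D' \<subseteq> C" "ffree (C - cn (insert x D'))" "(k + 1) * card D' + k \<le> card C"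
        using spec_good_rel True by metis
      have "ffree (C - cn (insert x D \<union> D'))"
        by (rule ffree_mono[OF D'(2)]) (use fin in \<open>auto simp: cn_def\<close>)
      then show ?thesis using D' unfolding good_rel_def by (intro exI[of _ D']) auto
    qed
  qed (use assms in auto)
  moreover have ST: "S - ?T - cn (insert x D) = C0 - cn (insert x D)"
    using C0 by (auto simp: cn_def)
  moreover have "S - ?T = insert x C0" using C0 assms(3) by auto
  moreover have "x \<notin> D" "x \<notin> C0" using D C0 by auto
  moreover have "finite D" "finite C0" using D C0 assms(1) by (auto intro: finite_subset)
  moreover have "no_edges ?T (C0 - cn (insert x D))"
    using C0 adj_sym unfolding no_edges_def by blast
  ultimately show ?thesis
    using D C0 assms(1,3) by (intro good_extend[of S "insert x D" ?T]) auto
qed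

section \<open>The upper bound\<close>

text \<open>As degrees are below \<open>k\<close>, a part \<open>W\<close> with internal degrees at
  least \<open>k - 1\<close> uses all neighbours of its vertices; so it is closed and, by
  connectedness, equals \<open>S\<close>. Removing the neighbourhood of any single vertex then
  leaves no such part.\<close>

lemma good_if_small_degree:
  assumes "finite S" "conn S" "\<not> spec S" and deg: "\<And>u. u \<in> S \<Longrightarrow> card (nb S u) < k"
  shows "good S"
proof -
  have all: "W = S \<and> (\<forall>u\<in>S. card (nb S u) = k - 1)"
    if W: "W \<subseteq> S" "W \<noteq> {}" "\<forall>u\<in>W. k - 1 \<le> card (nb W u)" for W
  proof -
    have eq: "nb W u = nb S u \<and> card (nb S u) = k - 1" if "u \<in> W" for u
    proof -
      have "card (nb S u) \<le> card (nb W u)" "u \<in> S" using W that deg[of u] by fastforce+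
      then show ?thesis
        using W that deg[of u] card_seteq[OF finite_nb[OF assms(1)] nb_mono[OF W(1)]]
        by fastforce
    qed
    have "no_edges W (S - W)" using eq by (auto simp: no_edges_def nb_def)
    then have "W = S" using connD assms(2) W by blast
    then show ?thesis using eq by blast
  qed
  show ?thesis
  proof (cases "ffree S")
    case True
    then show ?thesis unfolding good_rel_def by (intro exI[of _ "{}"]) (auto simp: cn_def)
  next
    case False
    then obtain W where "W \<subseteq> S" "W \<noteq> {}" "\<forall>u\<in>W. k - 1 \<le> card (nb W u)"
      using deg unfolding ffree_def by (auto simp: not_less)
    then have reg: "\<forall>u\<in>S. card (nb S u) = k - 1" using all by blast
    obtain u where u: "u \<in> S" using assms(2) by (auto simp: conn_def)
    have ge: "card S \<ge> k" using card_nb_less[OF assms(1) u] reg u by auto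
    \<comment> \<open>A \<open>(k - 1)\<close>-regular graph on \<open>k\<close> vertices would be a
      clique, hence special; so there are at least \<open>k + 1\<close> vertices to pay for
      \<open>u\<close>.\<close>
    have "card S \<noteq> k"
    proof
      assume k: "card S = k"
      have "adj u w" if uw: "u \<in> S" "w \<in> S" "u \<noteq> w" for u w
      proof -
        have "nb S u \<subseteq> S - {u}" by (auto simp: nb_def adj_irrefl)
        moreover have "card (S - {u}) \<le> card (nb S u)" using k reg uw assms(1) by simp
        ultimately have "nb S u = S - {u}" using assms(1) by (intro card_seteq) auto
        then show ?thesis using uw by (auto simp: nb_def)
      qed
      then show False using assms(3) k by (auto simp: spec_def clique_def)
    qed
    then have "k + 1 \<le> card S" using ge by simp
    moreover have "ffree (S - cn {u})"
      unfolding ffree_def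
    proof (intro conjI ballI allI impI)
      fix w assume "w \<in> S - cn {u}"
      then show "card (nb (S - cn {u}) w) < k"
        using deg[of w] card_nb_mono[OF assms(1), of "S - cn {u}" w] by auto
    next
      fix W assume W: "W \<subseteq> S - cn {u} \<and> W \<noteq> {}"
      then have "W \<noteq> S" using u by (auto simp: cn_def)
      then show "\<exists>u\<in>W. card (nb W u) < k - 1"
        using all[of W] W by (meson Diff_subset not_less order_trans)
    qed
    ultimately show ?thesis
      using u unfolding good_rel_def by (intro exI[of _ "{u}"]) auto
  qed
qed

text \<open>\<open>h\<close> has \<open>k - 1\<close> neighbours inside the clique, and the degree
  bound leaves room for only one more.\<close>

lemma clique_outer_nb_unique:
  assumes "finite S" "clique H" "H \<subseteq> S" "card H = k" "h \<in> H" "card (nb S h) \<le> k"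
    and "a \<in> nb S h - H" "b \<in> nb S h - H"
  shows "a = b"
proof (rule ccontr)
  assume "a \<noteq> b"
  have finH: "finite H" using assms finite_subset by blast
  have "card (nb H h \<union> {a, b}) = card (nb H h) + card {a, b}"
    using assms finH by (intro card_Un_disjoint finite_nb) (auto simp: nb_def)
  moreover have "card (nb H h) = k - 1"
    using card_nb_clique[OF assms(2) finH assms(5)] assms(4) by simp
  moreover have "nb H h \<union> {a, b} \<subseteq> nb S h" using assms by (auto simp: nb_def)
  then have "card (nb H h \<union> {a, b}) \<le> card (nb S h)"
    using assms(1) by (intro card_mono finite_nb)
  ultimately show False using assms(6) \<open>a \<noteq> b\<close> k_pos by simp
qed

text \<open>Here \<open>x\<close> joins the cliques \<open>H\<close> and \<open>G\<close>, which are also joined by the edge \<open>m w\<close>. Taking \<open>w\<close> together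
  with an isolating set of \<open>x\<close> and the rest \<open>T\<close> fails only if \<open>x\<close> is adjacent to all of \<open>H - {m}\<close>; then
  \<open>T\<close> is empty by the degree bound, and \<open>x\<close> alone works unless the graph is a 5-cycle.\<close>
lemma two_cliques_and_path:
  assumes fin: "finite S" and con: "conn S" and nspec: "\<not> spec S"
    and IH: "\<And>C. card C < card S \<Longrightarrow> finite C \<Longrightarrow> conn C \<Longrightarrow> \<not> spec C \<Longrightarrow> good C"
    and deg: "\<And>u. u \<in> S \<Longrightarrow> card (nb S u) \<le> k"
    and S: "S = H \<union> G \<union> insert x T"
    and disj: "H \<inter> G = {}" "x \<notin> H" "x \<notin> G" "x \<notin> T" "T \<inter> H = {}" "T \<inter> G = {}"
    and H: "clique H" "card H = k" and G: "clique G" "card G = k"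
    and T: "no_edges T (H \<union> G)" "\<And>C. comp T C \<Longrightarrow> \<not> spec C"
    and v: "v \<in> G" "adj x v" and y: "y \<in> H" "adj x y"
    and mw: "m \<in> H" "w \<in> G" "adj m w"
  shows "good S"
proof -
  have finH: "finite H" and finG: "finite G" and finT: "finite T"
    using fin S by auto
  have inS: "v \<in> S" "y \<in> S" "m \<in> S" "w \<in> S" "x \<in> S" using S v y mw by auto
  have nbH: "a = b" if "h \<in> H" "a \<in> nb S h - H" "b \<in> nb S h - H" for h a b
    by (rule clique_outer_nb_unique[OF fin H(1) _ H(2) that(1) deg that(2,3)]) (use S that in auto)
  have nbG: "a = b" if "h \<in> G" "a \<in> nb S h - G" "b \<in> nb S h - G" for h a b
    by (rule clique_outer_nb_unique[OF fin G(1) _ G(2) that(1) deg that(2,3)]) (use S that in auto)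
  \<comment> \<open>Outer neighbours are unique: \<open>x\<close> for \<open>y\<close> and
    \<open>v\<close>, \<open>w\<close> for \<open>m\<close>, and \<open>m\<close> for
    \<open>w\<close>. Hence the two connections between the cliques have different ends.\<close>
  have "m \<noteq> y"
  proof
    assume "m = y"
    then have "x = w"
      using y mw inS disj adj_sym by (intro nbH[of m]) (auto simp: nb_def)
    then show False using mw disj by auto
  qed
  have wv: "w \<noteq> v"
  proof
    assume "w = v"
    then have "x = m"
      using v mw inS disj adj_sym by (intro nbG[of w]) (auto simp: nb_def)
    then show False using mw disj by auto
  qed
  have k2: "2 \<le> k"
    using card_mono[OF finH, of "{m, y}"] H(2) mw y \<open>m \<noteq> y\<close> by simp
  let ?G' = "insert x T"
  have cardS: "card S = 2 * k + card ?G'"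
  proof -
    have "card S = card (H \<union> G) + card ?G'"
      using S disj finH finG finT by (subst S, intro card_Un_disjoint) auto
    moreover have "card (H \<union> G) = card H + card G"
      using disj finH finG by (intro card_Un_disjoint) auto
    ultimately show ?thesis using H G by simp
  qed
  have "good ?G'"
  proof (rule good_rel_components)
    fix C assume C: "comp ?G' C"
    then have sub: "C \<subseteq> ?G'" by (simp add: comp_def)
    have finC: "finite C" using sub finT finite_subset by blast
    have "card C < card S"
      using card_mono[OF _ sub] finT cardS k_pos by simp
    moreover have "\<not> spec C"
    proof (cases "x \<in> C")
      case False
      then have "comp T C" using C unfolding comp_def no_edges_def by blast
      then show ?thesis using T by blast
    next
      case True
      \<comment> \<open>Together with \<open>v\<close> and \<open>y\<close>, a special component
        would give \<open>x\<close> at least \<open>k + 1\<close> neighbours.\<close>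
      show ?thesis
      proof
        assume "spec C"
        then have "k - 1 \<le> card (nb C x)" using card_nb_spec True by blast
        moreover have "card (nb C x \<union> {v, y}) = card (nb C x) + card {v, y}"
          using sub v y disj finC by (intro card_Un_disjoint finite_nb) (auto simp: nb_def)
        moreover have "nb C x \<union> {v, y} \<subseteq> nb S x"
          using sub S v y by (auto simp: nb_def)
        then have "card (nb C x \<union> {v, y}) \<le> k"
          using deg[OF inS(5)] card_mono[OF finite_nb[OF fin]] le_trans by blast
        moreover have "v \<noteq> y" using v(1) y(1) disj(1) by blast
        ultimately show False by simp
      qed
    qed
    ultimately show "good C" using IH finC C by (auto simp: comp_def)
  qed (use finT in auto)
  then obtain D' where D': "D' \<subseteq> ?G'" "ffree (?G' - cn D')" "(k + 1) * card D' \<le> card ?G'"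
    by (auto simp: good_rel_def)
  let ?R = "S - cn (insert w D')"
  have Rsub: "?R \<subseteq> (H - {m}) \<union> (?G' - cn D')"
    using S G(1) mw adj_sym unfolding cn_def clique_def by blast
  have finR: "finite ?R" using fin by simp
  show ?thesis
  proof (cases "ffree ?R")
    case True
    have "finite D'" using D' finT finite_subset by auto
    then have "(k + 1) * card (insert w D') \<le> (k + 1) * (card D' + 1)"
      by (intro mult_le_mono2) (simp add: card_insert_if)
    moreover have "(k + 1) * (card D' + 1) \<le> card S" using D'(3) cardS k_pos by simp
    ultimately have "(k + 1) * card (insert w D') \<le> card S" by simp
    then show ?thesis
      unfolding good_rel_def using True D' S mw by (intro exI[of _ "insert w D'"]) auto
  next
    case False
    have less: "card (nb ?R u) < k" if "u \<in> S" "z \<in> nb S u" "z \<notin> ?R" for u z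
    proof -
      have "nb ?R u \<subset> nb S u" using that by (auto simp: nb_def)
      then have "card (nb ?R u) < card (nb S u)" using fin by (intro psubset_card_mono finite_nb)
      then show ?thesis using deg[OF that(1)] by simp
    qed
    \<comment> \<open>No star survives: a vertex of \<open>H - {m}\<close> has lost
      \<open>m\<close>, \<open>x\<close> has lost \<open>v\<close>, and \<open>T\<close> is handled
      by \<open>D'\<close>. So a failure is due to a part \<open>W\<close> of minimum degree at
      least \<open>k - 1\<close>.\<close>
    have "card (nb ?R u) < k" if u: "u \<in> ?R" for u
    proof -
      consider "u \<in> H - {m}" | "u = x" | "u \<in> T - cn D'" using u Rsub by blast
      then show ?thesis
      proof cases
        case 1
        then show ?thesis
          using less[of u m] u mw H(1) inS Rsub disj
          by (auto simp: nb_def clique_def)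
      next
        case 2
        then show ?thesis
          using less[of u v] v inS Rsub disj by (auto simp: nb_def)
      next
        case 3
        have "nb ?R u \<subseteq> nb (?G' - cn D') u"
          using 3 Rsub no_edgesD[OF T(1), of u] by (auto simp: nb_def)
        then have "card (nb ?R u) \<le> card (nb (?G' - cn D') u)"
          using finT by (intro card_mono finite_nb) auto
        also have "\<dots> < k" using 3 D' by (auto simp: ffree_def)
        finally show ?thesis .
      qed
    qed
    then obtain W where W: "W \<subseteq> ?R" "W \<noteq> {}" "\<And>u. u \<in> W \<Longrightarrow> k - 1 \<le> card (nb W u)"
      using False unfolding ffree_def by (auto simp: not_less)
    have "W \<inter> H \<noteq> {}"
    proof
      assume "W \<inter> H = {}"
      then have "W \<subseteq> ?G' - cn D'" using W Rsub by blast
      then obtain u where "u \<in> W" "card (nb W u) < k - 1"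
        using W D'(2) unfolding ffree_def by blast
      then show False using W(3)[of u] by simp
    qed
    \<comment> \<open>Of the neighbours of \<open>h\<close>, only \<open>x\<close> and
      \<open>H - {m, h}\<close> can survive, which are exactly \<open>k - 1\<close> vertices; so all
      of them are neighbours in \<open>W\<close>.\<close>
    have nbW: "nb W h = insert x (H - {m, h})" if "h \<in> W \<inter> H" for h
    proof (rule card_seteq)
      show "nb W h \<subseteq> insert x (H - {m, h})"
        using that W Rsub no_edgesD[OF T(1), of _ h] adj_irrefl adj_sym
        by (fastforce simp: nb_def)
      have "h \<noteq> m" using that W Rsub mw disj by auto
      then have "card (insert x (H - {m, h})) = k - 1"
        using that mw H(2) finH disj k2 by (simp add: card_Diff_subset)
      then show "card (insert x (H - {m, h})) \<le> card (nb W h)"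
        using W(3) that by simp
    qed (use finH in auto)
    obtain h where h: "h \<in> W \<inter> H" using \<open>W \<inter> H \<noteq> {}\<close> by blast
    have "H - {m} \<subseteq> W" using nbW[OF h] h by (auto simp: nb_def)
    then have adjx: "adj x u" if "u \<in> H - {m}" for u
      using nbW[of u] that adj_sym by (auto simp: nb_def)
    \<comment> \<open>Adjacency to \<open>H - {m}\<close> and to \<open>v\<close> exhausts the
      degree bound at \<open>x\<close>, which leaves \<open>T\<close> without an edge to the
      rest.\<close>
    have nbx: "nb S x = insert v (H - {m})"
    proof (rule sym, rule card_seteq)
      show "insert v (H - {m}) \<subseteq> nb S x" using adjx v S by (auto simp: nb_def)
      have "card (insert v (H - {m})) = k" using v mw H disj finH k2 by (subst card_insert_disjoint) auto
      then show "card (nb S x) \<le> card (insert v (H - {m}))" using deg inS by simp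
    qed (use fin finite_nb in auto)
    have "T = {}"
    proof (rule ccontr)
      assume "T \<noteq> {}"
      have "\<not> adj t x" if "t \<in> T" for t
      proof
        assume "adj t x"
        then have "t \<in> nb S x" using that S adj_sym by (auto simp: nb_def)
        then have "t = v \<or> t \<in> H" unfolding nbx by auto
        then show False using that v(1) disj by blast
      qed
      then have "no_edges T (S - T)"
        using T(1) S by (auto simp: no_edges_def)
      then have "T = S" using connD con \<open>T \<noteq> {}\<close> S by blast
      then show False using S disj by auto
    qed
    then have S': "S = insert x (H \<union> G)" using S by auto
    have cardS': "card S = 2 * k + 1" using cardS \<open>T = {}\<close> by simp
    \<comment> \<open>Now \<open>{x}\<close> is tried. It leaves at most the \<open>k\<close>
      vertices of \<open>?M\<close>, and fails only if all of \<open>?M\<close> remains with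
      internal degrees at least \<open>k - 1\<close>. The only neighbour of \<open>m\<close> in
      \<open>?M\<close> can be \<open>w\<close>, so \<open>k = 2\<close> and the whole graph is the
      5-cycle \<open>x y m w v\<close>.\<close>
    let ?R2 = "S - cn {x}" and ?M = "insert m (G - {v})"
    have R2: "?R2 \<subseteq> ?M" using S' v adjx by (auto simp: cn_def)
    have cardM: "card ?M = k"
      using v mw G disj finG k2 by (subst card_insert_disjoint) auto
    have cardR2: "card W \<le> k" if "W \<subseteq> ?R2" for W
      using that R2 cardM card_mono[of ?M W] finG by auto
    have "ffree ?R2"
    proof (rule ccontr)
      assume "\<not> ffree ?R2"
      moreover have "card (nb ?R2 u) < k" if "u \<in> ?R2" for u
        using card_nb_less[of ?R2 u] that cardR2[of ?R2] fin by auto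
      ultimately obtain W where W: "W \<subseteq> ?R2" "W \<noteq> {}" "\<And>u. u \<in> W \<Longrightarrow> k - 1 \<le> card (nb W u)"
        unfolding ffree_def by (auto simp: not_less)
      obtain u where u: "u \<in> W" using W by blast
      have finW: "finite W" using W fin finite_subset by blast
      have "k \<le> card W" using card_nb_less[OF finW u] W(3)[OF u] by simp
      then have "W = ?M" using W R2 cardM finG by (intro card_seteq) auto
      then have "m \<in> W" by simp
      have "nb W m \<subseteq> {w}"
      proof
        fix z assume z: "z \<in> nb W m"
        then have "z \<in> G" using \<open>W = ?M\<close> adj_irrefl by (auto simp: nb_def)
        then have "z = w"
          using z mw inS S disj by (intro nbH[of m]) (auto simp: nb_def)
        then show "z \<in> {w}" by auto
      qed
      then have "card (nb W m) \<le> 1" using card_mono[of "{w}"] by fastforce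
      then have "k = 2" using W(3)[OF \<open>m \<in> W\<close>] k2 by simp
      have "H = {y, m}"
        using card_seteq[OF finH, of "{y, m}"] \<open>k = 2\<close> H(2) y mw \<open>m \<noteq> y\<close> by auto
      moreover have "G = {v, w}"
        using card_seteq[OF finG, of "{v, w}"] \<open>k = 2\<close> G(2) v mw wv by auto
      ultimately have SS: "S = {x, y, m, w, v}" using S' by auto
      have "\<not> adj y w"
      proof
        assume "adj y w"
        then have "x = w"
          using y mw inS disj adj_sym by (intro nbH[of y]) (auto simp: nb_def)
        then show False using mw disj by auto
      qed
      moreover have "\<not> adj y v"
      proof
        assume "adj y v"
        then have "x = v"
          using y v mw inS disj adj_sym by (intro nbH[of y]) (auto simp: nb_def)
        then show False using v disj by auto
      qed
      moreover have "\<not> adj m v"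
      proof
        assume "adj m v"
        then have "w = v"
          using v mw inS disj adj_sym by (intro nbH[of m]) (auto simp: nb_def)
        then show False using wv by auto
      qed
      moreover have "\<not> adj x m" "\<not> adj x w"
      proof -
        have adjx_iff: "adj x u \<longleftrightarrow> u = v \<or> u \<in> H - {m}" if "u \<in> S" for u
          using nbx that by (auto simp: nb_def set_eq_iff)
        show "\<not> adj x m" using adjx_iff[OF inS(3)] mw(1) v(1) disj(1) by blast
        show "\<not> adj x w" using adjx_iff[OF inS(4)] mw(2) wv disj(1) by blast
      qed
      moreover have "adj y m" "adj w v"
        using H(1) G(1) y v mw \<open>m \<noteq> y\<close> wv by (auto simp: clique_def)
      ultimately have "cyc5 x y m w v"
        unfolding cyc5_def using mw y v wv \<open>m \<noteq> y\<close> disj adj_commute by auto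
      then have "spec S" unfolding spec_def using \<open>k = 2\<close> SS by blast
      then show False using nspec by blast
    qed
    then show ?thesis
      unfolding good_rel_def using inS cardS' k2 by (intro exI[of _ "{x}"]) auto
  qed
qed

section \<open>Configurations around a 5-cycle, with \<open>k = 2\<close>\<close>

lemma good_if_two_left:
  assumes "finite S" "k = 2" "D0 \<subseteq> S" "T \<subseteq> S" "good T"
    and "S - T - cn D0 \<subseteq> {p, q}" "\<not> adj p q" "no_edges T {p, q}"
    and "3 * card D0 \<le> card (S - T)"
  shows "good S"
proof (rule good_extend[OF assms(1,3,4)])
  show "good_rel D0 T" using assms good_rel_mono finite_subset by blast
  show "no_edges T (S - T - cn D0)" using assms(6,8) unfolding no_edges_def by blast
  have "no_edges {p, q} {p, q}" using assms(7) adj_sym adj_irrefl by (auto simp: no_edges_def)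
  then have "no_edges (S - T - cn D0) (S - T - cn D0)"
    using assms(6) unfolding no_edges_def by blast
  then show "ffree (S - T - cn D0)" using assms(2) by (intro ffree_indep) auto
qed (use assms in auto)

text \<open>Outside \<open>T\<close> there are 8 vertices, which pay for two. The pair
  \<open>{x, d}\<close> leaves at most \<open>a\<close> and \<open>m\<close>; should these be
  adjacent, \<open>{a, v}\<close> leaves at most \<open>d\<close> and \<open>y\<close>, which are
  not.\<close>

lemma cycle_and_edge:
  assumes fin: "finite S" and k2: "k = 2" and S: "S = {y, m} \<union> {v, a, c, d, b} \<union> insert x T"
    and disj: "distinct [y, m, v, a, c, d, b, x]" "{y, m, v, a, c, d, b, x} \<inter> T = {}"
    and cyc: "cyc5 v a c d b"
    and adj: "adj x y" "adj x v" "adj y m"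
    and no: "no_edges T ({y, m} \<union> {v, a, c, d, b})" "no_edges {c, d} {y, m}"
    and T: "good T"
  shows "good S"
proof -
  have ST: "S - T = {y, m, v, a, c, d, b, x}" using S disj(2) by blast
  have card: "card (S - T) = 8" unfolding ST using disj(1) by simp
  have sub: "T \<subseteq> S" using S by blast
  note edges = cyc[unfolded cyc5_def] adj
  show ?thesis
  proof (cases "adj m a")
    case True
    have "S - T - cn {a, v} \<subseteq> {d, y}"
      unfolding ST cn_def using edges True adj_commute by auto
    moreover have "\<not> adj d y" "no_edges T {d, y}" using no by (auto simp: no_edges_def)
    moreover have "card {a, v} = 2" using disj by auto
    ultimately show ?thesis
      using good_if_two_left[OF fin k2 _ sub T, of "{a, v}" d y] card S by auto
  next
    case False
    have "S - T - cn {x, d} \<subseteq> {a, m}"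
      unfolding ST cn_def using edges adj_commute by auto
    moreover have "\<not> adj a m" using False adj_commute by blast
    moreover have "no_edges T {a, m}" using no by (auto simp: no_edges_def)
    moreover have "card {x, d} = 2" using disj by auto
    ultimately show ?thesis
      using good_if_two_left[OF fin k2 _ sub T, of "{x, d}" a m] card S by auto
  qed
qed

text \<open>Outside \<open>T\<close> there are 11 vertices, which pay for three. Besides
  \<open>x\<close> and \<open>c\<close>, which leave at most \<open>b\<close> of the second cycle,
  \<open>q\<close> or \<open>r\<close> leaves at most \<open>s\<close> or \<open>p\<close> of the
  first. Adjacent to both, \<open>b\<close> would have degree at least 4.\<close>

lemma cycle_and_cycle:
  assumes fin: "finite S" and k2: "k = 2"
    and S: "S = {y, p, q, r, s} \<union> {v, a, c, d, b} \<union> insert x T"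
    and disj: "distinct [y, p, q, r, s, v, a, c, d, b, x]"
      "{y, p, q, r, s, v, a, c, d, b, x} \<inter> T = {}"
    and cyc: "cyc5 y p q r s" "cyc5 v a c d b"
    and adj: "adj x y" "adj x v"
    and deg: "card (nb S b) \<le> 3"
    and no: "no_edges T ({y, p, q, r, s} \<union> {v, a, c, d, b})"
    and T: "good T"
  shows "good S"
proof -
  have ST: "S - T = {y, p, q, r, s, v, a, c, d, b, x}" using S disj(2) by blast
  have card: "card (S - T) = 11" unfolding ST using disj(1) by simp
  have sub: "T \<subseteq> S" using S by blast
  note edges = cyc[unfolded cyc5_def] adj
  show ?thesis
  proof (cases "adj b s")
    case False
    have "S - T - cn {x, c, q} \<subseteq> {b, s}"
      unfolding ST cn_def using edges adj_commute by auto
    moreover have "no_edges T {b, s}" using no by (auto simp: no_edges_def)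
    moreover have "card {x, c, q} = 3" using disj by auto
    ultimately show ?thesis
      using good_if_two_left[OF fin k2 _ sub T, of "{x, c, q}" b s] card S False by auto
  next
    case True
    have "\<not> adj b p"
    proof
      assume "adj b p"
      then have "{v, d, s, p} \<subseteq> nb S b"
        using True edges adj_commute S by (auto simp: nb_def)
      then have "card {v, d, s, p} \<le> 3"
        using deg card_mono[OF finite_nb[OF fin]] le_trans by blast
      then show False using disj(1) by auto
    qed
    moreover have "S - T - cn {x, c, r} \<subseteq> {b, p}"
      unfolding ST cn_def using edges adj_commute by auto
    moreover have "no_edges T {b, p}" using no by (auto simp: no_edges_def)
    moreover have "card {x, c, r} = 3" using disj by auto
    ultimately show ?thesis
      using good_if_two_left[OF fin k2 _ sub T, of "{x, c, r}" b p] card S by auto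
  qed
qed

section \<open>The induction on the number of vertices\<close>

theorem good_connected:
  assumes "finite S" "conn S" "\<not> spec S"
  shows "good S"
  using assms
proof (induction "card S" arbitrary: S rule: less_induct)
  case less
  note fin = less.prems(1) and con = less.prems(2) and nspec = less.prems(3)
  have IH: "good C" if "card C < card S" "finite C" "conn C" "\<not> spec C" for C
    using less.hyps that by blast
  have "S \<noteq> {}" using con by (auto simp: conn_def)
  then have "Max ((\<lambda>u. card (nb S u)) ` S) \<in> (\<lambda>u. card (nb S u)) ` S"
    using fin by (intro Max_in) auto
  then obtain v where v: "v \<in> S" "Max ((\<lambda>u. card (nb S u)) ` S) = card (nb S v)" by auto
  have vmax: "card (nb S u) \<le> card (nb S v)" if "u \<in> S" for u
    using v(2) Max_ge[of "(\<lambda>u. card (nb S u)) ` S" "card (nb S u)"] fin that by simp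
  consider (small) "card (nb S v) < k"
    | (cut) x C0 where "x \<in> S" "comp (S - {x}) C0" "spec C0"
    | (main) "k \<le> card (nb S v)" "\<And>x C. x \<in> S \<Longrightarrow> comp (S - {x}) C \<Longrightarrow> \<not> spec C"
    by (meson not_less)
  then show "good S"
  proof cases
    case small
    then show ?thesis
      using good_if_small_degree[OF fin con nspec] vmax le_less_trans by blast
  next
    case cut
    then show ?thesis using good_if_cut_special[OF fin con] IH by blast
  next
    case main
    let ?U = "S - cn {v}"
    \<comment> \<open>Summing over components extends the induction hypothesis to disconnected
      proper subsets.\<close>
    have good_nonspec: "good T" if "T \<subset> S" "\<And>C. comp T C \<Longrightarrow> \<not> spec C" for T
    proof (rule good_rel_components)
      show "finite T" using that fin finite_subset by blast
      fix C assume C: "comp T C"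
      then have "C \<subset> S" using that by (auto simp: comp_def)
      then show "good C"
        using IH[of C] C that fin by (auto simp: comp_def psubset_card_mono finite_subset)
    qed
    show ?thesis
    proof (cases "\<exists>H. comp ?U H \<and> spec H")
      case False
      have "?U \<subset> S" using v by (auto simp: cn_def)
      then have "good ?U" using good_nonspec False by blast
      then have "good_rel {v} ?U" using good_rel_mono fin by blast
      moreover have "insert v (nb S v) \<subseteq> S - ?U" using v by (auto simp: nb_def cn_def)
      then have "card (insert v (nb S v)) \<le> card (S - ?U)" using fin by (intro card_mono) auto
      then have "k + 1 \<le> card (S - ?U)"
        using main(1) finite_nb[OF fin] adj_irrefl by (simp add: nb_def)
      moreover have U_empty: "S - ?U - cn {v} = {}" by auto
      have "ffree (S - ?U - cn {v})" unfolding U_empty by (rule ffree_empty)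
      ultimately show ?thesis
        using v fin by (intro good_extend[of S "{v}" ?U]) (auto simp: no_edges_def)
    next
      case True
      then obtain H where H: "comp ?U H" "spec H" by blast
      have HU: "H \<subseteq> ?U" and nH: "no_edges H (?U - H)" and cH: "conn H"
        using H by (auto simp: comp_def)
      have finH: "finite H" using HU fin finite_subset by blast
      \<comment> \<open>\<open>H\<close> is a component outside \<open>N[v]\<close>, so it can be
        left only through a neighbour of \<open>v\<close>.\<close>
      have outer: "adj v u" if "h \<in> H" "adj h u" "u \<in> S - H" for h u
      proof -
        have "u \<notin> ?U - H" using nH that by (auto simp: no_edges_def)
        then have "u \<in> cn {v}" using that by auto
        moreover have "u \<noteq> v" using that HU adj_sym by (auto simp: cn_def)
        ultimately show ?thesis by (auto simp: cn_def)
      qed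
      have vH: "v \<notin> H" using HU by (auto simp: cn_def)
      have "\<not> no_edges H (S - H)"
        using connD[OF con, of H] HU cH vH v by (auto simp: conn_def)
      then obtain y x where yx: "y \<in> H" "adj y x" "x \<in> S - H" unfolding no_edges_def by blast
      have vx: "adj v x" using outer yx by blast
      have xy: "adj x y" "adj x v" using yx vx adj_sym by blast+
      \<comment> \<open>\<open>S\<close> splits into \<open>H\<close>, the joining vertex
        \<open>x\<close>, the component \<open>G\<close> of \<open>v\<close>, and the rest
        \<open>?T\<close>. No edge runs from \<open>?T\<close> to \<open>H\<close> or
        \<open>G\<close>, so its components are components of \<open>S - {x}\<close> and thus not
        special.\<close>
      let ?R = "S - H - {x}"
      have vR: "v \<in> ?R" using v vH vx adj_irrefl by auto
      then obtain G where G: "comp ?R G" "v \<in> G" using comp_exists[of ?R v] fin by auto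
      have GR: "G \<subseteq> ?R" and nG: "no_edges G (?R - G)" using G by (auto simp: comp_def)
      have finG: "finite G" using GR fin finite_subset by blast
      let ?T = "?R - G"
      have TU: "?T \<subseteq> ?U - H"
      proof
        fix t assume t: "t \<in> ?T"
        then have "t \<noteq> v" "\<not> adj v t" using no_edgesD[OF nG G(2)] G(2) by auto
        then show "t \<in> ?U - H" using t by (auto simp: cn_def)
      qed
      have nT: "no_edges ?T (H \<union> G)"
        using TU nH nG adj_sym unfolding no_edges_def by blast
      have nspecT: "\<not> spec C" if C: "comp ?T C" for C
      proof -
        have "comp (S - {x}) C"
        proof (rule comp_superset[OF C])
          have "S - {x} - ?T \<subseteq> H \<union> G" by auto
          then show "no_edges C (S - {x} - ?T)"
            using C nT unfolding comp_def no_edges_def by blast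
        qed auto
        then show ?thesis using main(2) yx by blast
      qed
      have "?T \<subset> S" using yx(3) by auto
      then have goodT: "good ?T" using good_nonspec[OF _ nspecT] by simp
      have nbv: "nb S v \<subseteq> insert x (G - {v})"
      proof
        fix u assume u: "u \<in> nb S v"
        then have "u \<in> S" "adj v u" by (auto simp: nb_def)
        then have "u \<notin> H" "u \<noteq> v" "u \<notin> ?R - G"
          using HU no_edgesD[OF nG G(2)] adj_irrefl by (auto simp: cn_def)
        then show "u \<in> insert x (G - {v})" using \<open>u \<in> S\<close> by blast
      qed
      have Sdecomp: "S = H \<union> G \<union> insert x ?T" using HU GR yx by auto
      have disj: "H \<inter> G = {}" "x \<notin> H" "x \<notin> G" using GR yx by auto
      show ?thesis
      proof (cases "spec G")
        case False
        \<comment> \<open>Of the components of \<open>?R\<close>, only \<open>G\<close> could have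
          been special. The vertices of \<open>H\<close> and \<open>x\<close> pay for
          \<open>D\<close>, which dominates them all.\<close>
        obtain D where D: "D \<subseteq> H" "H \<subseteq> cn D" "y \<in> D" "(k + 1) * card D \<le> card H + 1"
          using spec_dominate[OF H(2) yx(1)] by blast
        have "\<not> spec C" if C: "comp ?R C" for C
        proof (cases "v \<in> C")
          case True
          then show ?thesis using comp_disjoint_or_eq[OF C G(1)] G(2) False by blast
        next
          case nv: False
          then have "C \<inter> G = {}" using comp_disjoint_or_eq[OF C G(1)] G(2) by blast
          then have "comp ?T C" using C unfolding comp_def no_edges_def by blast
          then show ?thesis using nspecT by blast
        qed
        moreover have "?R \<subset> S" using yx by auto
        ultimately have "good ?R" using good_nonspec[of ?R] by simp
        then have "good_rel D ?R" using good_rel_mono fin by blast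
        moreover have SR: "S - ?R = insert x H" using HU yx by auto
        moreover have "insert x H \<subseteq> cn D" using D yx by (auto simp: cn_def)
        then have R_empty: "S - ?R - cn D = {}" using SR by auto
        have "ffree (S - ?R - cn D)" unfolding R_empty by (rule ffree_empty)
        moreover have "D \<subseteq> S" using D HU by auto
        ultimately show ?thesis
          using D fin finH disj R_empty
          by (intro good_extend[of S D ?R]) (auto simp: no_edges_def)
      next
        case True
        from True G(2) show ?thesis
        proof (cases rule: spec_cases)
          case clique
          \<comment> \<open>The neighbours of \<open>v\<close> lie in \<open>G - {v}\<close> and
            \<open>x\<close>, so the maximum degree is at most \<open>k\<close>.\<close>
          have "card (nb S v) \<le> card (insert x (G - {v}))"
            using finG by (intro card_mono nbv) auto
          also have "\<dots> = k" using clique finG G(2) disj k_pos by simp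
          finally have deg: "card (nb S u) \<le> k" if "u \<in> S" for u using vmax that le_trans by blast
          \<comment> \<open>\<open>H\<close> is special and so cannot be a component of
            \<open>S - {x}\<close>: there is a second way out of \<open>H\<close>. It leads to a
            neighbour of \<open>v\<close>, hence into \<open>G\<close>.\<close>
          obtain m w where mw: "m \<in> H" "adj m w" "w \<in> S - {x} - H"
          proof -
            have "\<not> comp (S - {x}) H" using main(2) H(2) yx by blast
            then have "\<not> no_edges H (S - {x} - H)" using cH HU yx by (auto simp: comp_def)
            then show thesis using that unfolding no_edges_def by blast
          qed
          have "adj v w" using outer mw by auto
          then have "w \<in> G" using nbv mw by (auto simp: nb_def)
          from H(2) yx(1) show ?thesis
          proof (cases rule: spec_cases)
            case Hclique: clique
            show ?thesis
              by (rule two_cliques_and_path[OF fin con nspec IH deg Sdecomp disj _ _ _ Hclique(2,1)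
                    clique(2,1) nT nspecT G(2) xy(2) yx(1) xy(1) mw(1) \<open>w \<in> G\<close> mw(2)]) auto
          next
            case (cycle p q r s)
            \<comment> \<open>This case does not occur: \<open>y\<close> would have two neighbours
              on its 5-cycle and \<open>x\<close> as a third, while degrees are at most 2.\<close>
            have "{x, p, s} \<subseteq> nb S y"
              using cycle yx HU adj_sym by (auto simp: nb_def cyc5_def)
            then have "card {x, p, s} \<le> card (nb S y)" by (intro card_mono finite_nb fin)
            moreover have "card (nb S y) \<le> 2" using deg[of y] cycle(1) yx HU by auto
            moreover have "x \<noteq> p" "x \<noteq> s" "p \<noteq> s" using cycle disj by (auto simp: cyc5_def)
            ultimately show ?thesis by simp
          qed
        next
          case (cycle a c d b)
          have k2: "k = 2" using cycle by simp
          have "nb S v \<subseteq> {x, a, b}"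
            using nbv cycle(2,3) adj_commute by (auto simp: nb_def cyc5_def)
          then have "card (nb S v) \<le> card {x, a, b}" by (intro card_mono) auto
          also have "\<dots> \<le> 3" by (simp add: card_insert_if)
          finally have deg: "card (nb S u) \<le> 3" if "u \<in> S" for u using vmax that le_trans by blast
          \<comment> \<open>On the cycle, \<open>c\<close> and \<open>d\<close> are the vertices not
            adjacent to \<open>v\<close>. They lie outside \<open>N[v]\<close>, where
            \<open>H\<close> is a component, and so have no neighbour in \<open>H\<close>.\<close>
          have "{c, d} \<subseteq> ?U - H"
            using cycle(2,3) GR adj_commute by (auto simp: cn_def cyc5_def)
          then have ncd: "no_edges {c, d} H" using nH adj_sym unfolding no_edges_def by blast
          have dG: "distinct [v, a, c, d, b]" using cycle(3) by (simp add: cyc5_def)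
          from H(2) yx(1) show ?thesis
          proof (cases rule: spec_cases)
            case clique
            have "card (H - {y}) = 1" using clique k2 yx finH by simp
            then obtain m where "H - {y} = {m}" by (auto simp: card_1_singleton_iff)
            then have m: "H = {y, m}" "y \<noteq> m" using yx by auto
            then have "adj y m" using clique by (auto simp: clique_def)
            show ?thesis
              by (rule cycle_and_edge[OF fin k2 _ _ _ cycle(3) xy \<open>adj y m\<close> _ _ goodT])
                (use Sdecomp disj nT ncd m dG cycle(2) in auto)
          next
            case (cycle p q r s)
            have dH: "distinct [y, p, q, r, s]" using cycle(3) by (simp add: cyc5_def)
            have degb: "card (nb S b) \<le> 3" using deg \<open>G = {v, a, c, d, b}\<close> GR by auto
            show ?thesis
              by (rule cycle_and_cycle[OF fin k2 _ _ _ cycle(3) \<open>cyc5 v a c d b\<close> xy degb _ goodT])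
                (use Sdecomp disj nT dG dH cycle(2) \<open>G = {v, a, c, d, b}\<close> in auto)
          qed
        qed
      qed
    qed
  qed
qed

end

section \<open>Transfer to edge sets and sharpness\<close>

lemma sgraph_edges: "graph V E \<Longrightarrow> k \<ge> 1 \<Longrightarrow> sgraph (\<lambda>u w. {u, w} \<in> E) k"
  by unfold_locales (auto simp: graph_def insert_commute)

lemma edgeE:
  assumes "graph V E" "e \<in> E"
  obtains u w where "e = {u, w}" "u \<noteq> w" "u \<in> V" "w \<in> V"
  using assms unfolding graph_def by (metis card_2_iff insert_subset)

text \<open>The five sides come first and the five diagonals last, so that excluding the diagonals
  leaves the edges of a cycle.\<close>

lemma pair_of_five:
  assumes "u \<in> {a, b, c, d, e}" "w \<in> {a, b, c, d, e}" "u \<noteq> w"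
  shows "{u, w} = {a, b} \<or> {u, w} = {b, c} \<or> {u, w} = {c, d} \<or> {u, w} = {d, e} \<or>
    {u, w} = {e, a} \<or> {u, w} = {a, c} \<or> {u, w} = {b, d} \<or> {u, w} = {c, e} \<or>
    {u, w} = {d, a} \<or> {u, w} = {e, b}"
  using assms by (elim insertE emptyE) (simp_all add: insert_commute)

lemma special_if_spec:
  assumes "graph V E" "k \<ge> 1" "sgraph.spec (\<lambda>u w. {u, w} \<in> E) k V"
  shows "special k V E"
proof -
  interpret sgraph "\<lambda>u w. {u, w} \<in> E" k using sgraph_edges assms by blast
  show ?thesis
  proof (cases "card V = k \<and> clique V")
    case True
    have "complete_graph V E"
      unfolding complete_graph_def
    proof (intro equalityI subsetI)
      fix e assume "e \<in> E"
      then show "e \<in> {{u, v} |u v. u \<in> V \<and> v \<in> V \<and> u \<noteq> v}"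
        using edgeE[OF assms(1)] by blast
    next
      fix e assume "e \<in> {{u, v} |u v. u \<in> V \<and> v \<in> V \<and> u \<noteq> v}"
      then show "e \<in> E" using True unfolding clique_def by blast
    qed
    then show ?thesis using True by (simp add: special_def)
  next
    case False
    then obtain a b c d e where k2: "k = 2" and V: "V = {a, b, c, d, e}" and cyc: "cyc5 a b c d e"
      using assms(3) unfolding spec_def by blast
    note edges = cyc[unfolded cyc5_def]
    let ?f = "(!) [a, b, c, d, e]"
    have "bij_betw ?f {..<length [a, b, c, d, e]} (set [a, b, c, d, e])"
      using edges by (intro bij_betw_nth) auto
    then have bij: "bij_betw ?f {0..<5} V" using V by (simp add: lessThan_atLeast0 eval_nat_numeral)
    have less5: "i < 5 \<longleftrightarrow> i = 0 \<or> i = 1 \<or> i = 2 \<or> i = 3 \<or> i = 4" for i :: nat by auto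
    have "{{?f i, ?f ((i + 1) mod 5)} | i. i < 5} = {{a, b}, {b, c}, {c, d}, {d, e}, {e, a}}"
    proof -
      have "{{?f i, ?f ((i + 1) mod 5)} | i. i < 5} =
          (\<lambda>i. {?f i, ?f ((i + 1) mod 5)}) ` {0, 1, 2, 3, 4}"
        unfolding less5 by blast
      then show ?thesis by simp
    qed
    moreover have "E = {{a, b}, {b, c}, {c, d}, {d, e}, {e, a}}"
    proof (intro equalityI subsetI)
      fix x assume x: "x \<in> E"
      then obtain u w where uw: "x = {u, w}" "u \<noteq> w" "u \<in> V" "w \<in> V"
        using edgeE[OF assms(1)] by metis
      then have "{u, w} \<in> E" "{w, u} \<in> E" using x by (auto simp: insert_commute)
      then have "{u, w} \<noteq> {a, c}" "{u, w} \<noteq> {b, d}" "{u, w} \<noteq> {c, e}" "{u, w} \<noteq> {d, a}"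
        "{u, w} \<noteq> {e, b}" using edges by metis+
      moreover have "{u, w} = {a, b} \<or> {u, w} = {b, c} \<or> {u, w} = {c, d} \<or> {u, w} = {d, e} \<or>
          {u, w} = {e, a} \<or> {u, w} = {a, c} \<or> {u, w} = {b, d} \<or> {u, w} = {c, e} \<or>
          {u, w} = {d, a} \<or> {u, w} = {e, b}"
        by (rule pair_of_five) (use uw V in simp_all)
      ultimately show "x \<in> {{a, b}, {b, c}, {c, d}, {d, e}, {e, a}}"
        unfolding uw(1) insert_iff by argo
    qed (use edges in auto)
    ultimately have E: "E = {{?f i, ?f ((i + 1) mod 5)} | i. i < 5}" by (simp only:)
    have "is_C5 V E" unfolding is_C5_def by (rule exI[of _ ?f], rule conjI[OF bij E])
    then show ?thesis using k2 by (simp add: special_def)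
  qed
qed

lemma conn_if_connected_graph:
  assumes "graph V E" "connected_graph V E"
  shows "sgraph.conn (\<lambda>u w. {u, w} \<in> E) V"
proof -
  \<comment> \<open>\<open>conn\<close> is independent of \<open>k\<close>; the value 1 meets
    \<open>k_pos\<close>.\<close>
  interpret sgraph "\<lambda>u w. {u, w} \<in> E" 1 using sgraph_edges assms by blast
  have "W = V" if W: "W \<subseteq> V" "W \<noteq> {}" "no_edges W (V - W)" for W
  proof -
    obtain u where u: "u \<in> W" using W by blast
    have "v \<in> W" if "(u, v) \<in> {(x, y). {x, y} \<in> E}\<^sup>*" for v
      using that
    proof induction
      case base
      then show ?case by (rule u)
    next
      case (step y z)
      then have "z \<in> V" using assms(1) unfolding graph_def by blast
      then show ?case using step W(3) unfolding no_edges_def by blast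
    qed
    then show ?thesis using assms(2) W(1) u unfolding connected_graph_def by blast
  qed
  then show ?thesis using assms(2) unfolding conn_def connected_graph_def by blast
qed

text \<open>The centre of a star would have \<open>k\<close> neighbours. The degrees of a regular
  subgraph are at most those induced on its vertex set, where some vertex has degree less than
  \<open>k - 1\<close>.\<close>

lemma not_contains_F_if_ffree:
  assumes "graph V E" "k \<ge> 1" "S \<subseteq> V" "sgraph.ffree (\<lambda>u w. {u, w} \<in> E) k S"
  shows "\<not> contains_F k S (induced_edges E S)"
proof
  interpret sgraph "\<lambda>u w. {u, w} \<in> E" k using sgraph_edges assms by blast
  have fin: "finite S" using assms finite_subset by (auto simp: graph_def)
  assume "contains_F k S (induced_edges E S)"
  then obtain V' E' where "subgraph V' E' S (induced_edges E S)" and F: "F_graph k V' E'"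
    unfolding contains_F_def by blast
  then have sub: "V' \<subseteq> S" "E' \<subseteq> E" "\<forall>e\<in>E'. e \<subseteq> V'"
    by (auto simp: subgraph_def induced_edges_def)
  have "\<not> is_star k V' E'"
  proof
    assume "is_star k V' E'"
    then obtain c L where cL: "card L = k" "V' = insert c L" "E' = (\<lambda>l. {c, l}) ` L"
      unfolding is_star_def by blast
    then have "L \<subseteq> nb S c" using sub by (auto simp: nb_def)
    then have "k \<le> card (nb S c)" using card_mono[OF finite_nb[OF fin]] cL(1) by blast
    moreover have "c \<in> S" using cL(2) sub(1) by auto
    ultimately show False using assms(4) unfolding ffree_def by (meson not_less)
  qed
  then obtain r where r: "V' \<noteq> {}" "k - 1 \<le> r" "regular_of V' E' r"
    using F unfolding F_graph_def by blast
  then obtain u where u: "u \<in> V'" "card (nb V' u) < k - 1"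
    using assms(4) sub(1) unfolding ffree_def by blast
  have finV: "finite V'" using sub fin finite_subset by blast
  have "{e \<in> E'. u \<in> e} \<subseteq> (\<lambda>w. {u, w}) ` nb V' u"
  proof
    fix e assume e: "e \<in> {e \<in> E'. u \<in> e}"
    then have "e \<in> E" "e \<subseteq> V'" using sub by auto
    then obtain p q where "e = {p, q}" using edgeE[OF assms(1)] by metis
    then obtain w where "e = {u, w}" using e by (metis (mono_tags) insert_commute insert_iff mem_Collect_eq singletonD)
    then show "e \<in> (\<lambda>w. {u, w}) ` nb V' u"
      using \<open>e \<in> E\<close> \<open>e \<subseteq> V'\<close> by (auto simp: nb_def)
  qed
  then have "degree E' u \<le> card (nb V' u)"
    unfolding degree_def using surj_card_le[OF finite_nb[OF finV]] by blast
  then show False using u r unfolding regular_of_def by fastforce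
qed

lemma isolating_exists:
  assumes "graph V E" "k \<ge> 1" "connected_graph V E" "\<not> special k V E"
  obtains D where "isolating k V E D" "(k + 1) * card D \<le> card V"
proof -
  interpret sgraph "\<lambda>u w. {u, w} \<in> E" k using sgraph_edges assms by blast
  have "good V"
    using good_connected conn_if_connected_graph[OF assms(1,3)] special_if_spec[OF assms(1,2)] assms
    by (auto simp: graph_def)
  then obtain D where D: "D \<subseteq> V" "ffree (V - cn D)" "(k + 1) * card D \<le> card V"
    by (auto simp: good_rel_def)
  have "V - closed_nbhd_set V E D = V - cn D"
    by (auto simp: cn_def closed_nbhd_set_def closed_nbhd_def insert_commute)
  then have "isolating k V E D"
    using D not_contains_F_if_ffree[OF assms(1,2), of "V - cn D"] by (simp add: isolating_def)
  then show ?thesis using that D by blast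
qed

section \<open>Sharpness for \<open>B_{n,k}\<close>\<close>

lemma contains_F_clique:
  assumes "finite W" "W \<subseteq> S" "card W = k" "k \<ge> 1"
    and "\<And>u w. u \<in> W \<Longrightarrow> w \<in> W \<Longrightarrow> u \<noteq> w \<Longrightarrow> {u, w} \<in> E"
  shows "contains_F k S (induced_edges E S)"
proof -
  let ?E = "{{u, w} | u w. u \<in> W \<and> w \<in> W \<and> u \<noteq> w}"
  have "degree ?E u = k - 1" if u: "u \<in> W" for u
  proof -
    have "{e \<in> ?E. u \<in> e} = (\<lambda>w. {u, w}) ` (W - {u})"
      using u by (auto simp: insert_commute)
    moreover have "inj_on (\<lambda>w. {u, w}) (W - {u})"
      by (auto simp: inj_on_def doubleton_eq_iff)
    ultimately show ?thesis using u assms(1,3) by (simp add: degree_def card_image)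
  qed
  then have "F_graph k W ?E" using assms(3,4) by (auto simp: F_graph_def regular_of_def)
  moreover have "subgraph W ?E S (induced_edges E S)"
    using assms(2,5) by (auto simp: subgraph_def induced_edges_def)
  ultimately show ?thesis unfolding contains_F_def by blast
qed

text \<open>Sending \<open>d\<close> to the index of the block of \<open>f d\<close> must hit every
  full block: a missed block keeps all its vertices except possibly the first, and these form a
  \<open>k\<close>-clique, which is \<open>(k - 1)\<close>-regular.\<close>

lemma isolating_B_card:
  assumes "graph V E" "k \<ge> 1" "card V = n" "graph_iso V E (B_vert n) (B_edges n k)"
    and "isolating k V E D"
  shows "n div (k + 1) \<le> card D"
proof -
  obtain f where bij: "bij_betw f V {0..<n}"
      and edge: "\<And>u v. u \<in> V \<Longrightarrow> v \<in> V \<Longrightarrow> {u, v} \<in> E \<longleftrightarrow> {f u, f v} \<in> B_edges n k"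
    using assms(4) unfolding graph_iso_def B_vert_def by blast
  have DV: "D \<subseteq> V" using assms(5) by (simp add: isolating_def)
  have finV: "finite V" using assms(1) by (simp add: graph_def)
  let ?g = "\<lambda>d. f d div (k + 1)"
  have "{..<n div (k + 1)} \<subseteq> ?g ` D"
  proof (rule ccontr)
    assume "\<not> ?thesis"
    then obtain i where i: "i < n div (k + 1)" "\<And>d. d \<in> D \<Longrightarrow> f d div (k + 1) \<noteq> i" by auto
    \<comment> \<open>The first vertex of the block is left out, since it alone can have edges to
      other blocks and be dominated from there; \<open>k\<close> vertices remain.\<close>
    let ?I = "{i * (k + 1) + 1..<i * (k + 1) + (k + 1)}" and ?R = "V - closed_nbhd_set V E D"
    have "(i + 1) * (k + 1) \<le> n div (k + 1) * (k + 1)" using i(1) by (intro mult_le_mono1) simp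
    also have "\<dots> \<le> n" by (rule div_times_less_eq_dividend)
    finally have I_n: "?I \<subseteq> {0..<n}" by (auto simp: algebra_simps)
    have I_div: "x div (k + 1) = i \<and> x mod (k + 1) \<noteq> 0" if "x \<in> ?I" for x
    proof -
      have "x div (k + 1) = i"
        by (rule div_nat_eqI) (use that in \<open>auto simp: algebra_simps\<close>)
      moreover from this have "x mod (k + 1) = x - i * (k + 1)"
        using minus_div_mult_eq_mod[of x "k + 1"] by simp
      ultimately show ?thesis using that by auto
    qed
    define W where "W = {u \<in> V. f u \<in> ?I}"
    have "f ` W = f ` V \<inter> ?I" unfolding W_def by blast
    also have "\<dots> = ?I" unfolding bij_betw_imp_surj_on[OF bij] using I_n by (rule Int_absorb1)
    finally have fW: "f ` W = ?I" .
    have "inj_on f W"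
      using bij_betw_imp_inj_on[OF bij] by (rule inj_on_subset) (auto simp: W_def)
    then have "card W = card ?I" using card_image fW by metis
    then have cardW: "card W = k" by simp
    have clique: "{u, w} \<in> E" if uw: "u \<in> W" "w \<in> W" "u \<noteq> w" for u w
    proof -
      have "f u \<noteq> f w" using uw \<open>inj_on f W\<close> by (auto simp: inj_on_def)
      moreover have "f u \<in> ?I" "f w \<in> ?I" "u \<in> V" "w \<in> V"
        using uw unfolding W_def by simp_all
      moreover have "f u < n" "f w < n" using bij_betwE[OF bij] \<open>u \<in> V\<close> \<open>w \<in> V\<close> by auto
      moreover have "f u div (k + 1) = f w div (k + 1)"
        using I_div[OF \<open>f u \<in> ?I\<close>] I_div[OF \<open>f w \<in> ?I\<close>] by (simp only:)
      ultimately have "{f u, f w} \<in> B_edges n k" unfolding B_edges_def by blast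
      then show ?thesis using edge \<open>u \<in> V\<close> \<open>w \<in> V\<close> by blast
    qed
    have "W \<subseteq> ?R"
    proof
      fix w assume w: "w \<in> W"
      then have wI: "f w \<in> ?I" and wV: "w \<in> V" by (auto simp: W_def)
      have "w \<notin> closed_nbhd V E d" if d: "d \<in> D" for d
      proof
        assume "w \<in> closed_nbhd V E d"
        then have "w = d \<or> {w, d} \<in> E" by (auto simp: closed_nbhd_def)
        then have "{w, d} \<in> E" using i(2)[OF d] I_div[OF wI] by auto
        then have "{f w, f d} \<in> B_edges n k" using edge wV DV d by blast
        then obtain p q where pq: "{f w, f d} = {p, q}"
            "p div (k + 1) = q div (k + 1) \<or> (p mod (k + 1) = 0 \<and> q = p + (k + 1))"
          unfolding B_edges_def by (elim CollectE exE conjE) (rule that)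
        \<comment> \<open>\<open>f w\<close> may be either end of a joining edge; its ends
          \<open>p\<close> and \<open>p + (k + 1)\<close> are both multiples of
          \<open>k + 1\<close>.\<close>
        then have "f w div (k + 1) = f d div (k + 1) \<or> f w mod (k + 1) = 0"
          by (auto simp: doubleton_eq_iff simp del: One_nat_def add_Suc_right)
        then show False using i(2)[OF d] I_div[OF wI] by auto
      qed
      then show "w \<in> ?R" using wV by (auto simp: closed_nbhd_set_def)
    qed
    then have "contains_F k ?R (induced_edges E ?R)"
      using finV cardW assms(2) clique by (intro contains_F_clique[of W]) (auto simp: W_def)
    then show False using assms(5) by (simp add: isolating_def)
  qed
  then show ?thesis
    using surj_card_le[of D "{..<n div (k + 1)}" ?g] finite_subset[OF DV finV] by simp
qed

theorem theorem4:
  fixes V :: "'a set" and E :: "'a set set" and k n :: nat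
  assumes "graph V E" and "k \<ge> 1" and "connected_graph V E" and "card V = n"
    and "\<not> special k V E"
  shows "iota k V E \<le> n div (k + 1) \<and>
         (graph_iso V E (B_vert n) (B_edges n k) \<longrightarrow> iota k V E = n div (k + 1))"
proof -
  obtain D where D: "isolating k V E D" "(k + 1) * card D \<le> card V"
    using isolating_exists[OF assms(1-3,5)] by blast
  have "card D \<le> n div (k + 1)"
    using D(2) assms(4) by (simp add: less_eq_div_iff_mult_less_eq mult.commute)
  moreover have "iota k V E \<le> card D"
    unfolding iota_def by (rule Least_le) (use D in blast)
  ultimately have upper: "iota k V E \<le> n div (k + 1)" by simp
  have "\<exists>D. isolating k V E D \<and> card D = iota k V E"
    unfolding iota_def by (rule LeastI_ex) (use D in blast)
  then have "n div (k + 1) \<le> iota k V E" if "graph_iso V E (B_vert n) (B_edges n k)"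
    using isolating_B_card[OF assms(1,2,4) that] by metis
  then show ?thesis using upper by auto
qed

end
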